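(* Let $n\ge3$ and let $m=x_1<x_2<\cdots<x_n=M$ be any $n$ distinct integers. Then $$m_4\le(M-\bar{x})(\bar{x}-m)m_2+(M+m-2\bar{x})m_3-\frac{\left(m_3-(m+M-2\bar{x})m_2\right)^2}{(M-\bar{x})(\bar{x}-m)-m_2}-\beta_2,$$ where $$\beta_2=\begin{cases}\frac{1}{480}(n-2)(n-4)(4n^2-11n+2), & n\text{ even},\\[2pt] \frac{1}{480n}(n-1)(n-3)(4n^3-19n^2+32n-5), & n\text{ odd}.\end{cases}$$
   Context: $\bar x=\frac1n\sum_{i=1}^n x_i$ is the arithmetic mean and $m_s=\frac1n\sum_{i=1}^n(x_i-\bar x)^s$ is the $s$-th central moment (about the mean). *)

theory Defs
  imports Complex_Main
begin

definition arith_mean :: "nat \<Rightarrow> (nat \<Rightarrow> real) \<Rightarrow> real" where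
  "arith_mean n x = (\<Sum>i=1..n. x i) / real n"

definition central_moment :: "nat \<Rightarrow> nat \<Rightarrow> (nat \<Rightarrow> real) \<Rightarrow> real" where
  "central_moment s n x = (\<Sum>i=1..n. (x i - arith_mean n x) ^ s) / real n"

definition beta2 :: "nat \<Rightarrow> real" where
  "beta2 n =
    (if even n
     then 1 / 480 * (real n - 2) * (real n - 4) * (4 * real n ^ 2 - 11 * real n + 2)
     else 1 / (480 * real n) * (real n - 1) * (real n - 3)
            * (4 * real n ^ 3 - 19 * real n ^ 2 + 32 * real n - 5))"

end

(* Put w i = (M - x i) * (x i - m) and t i = x i - a. The right-hand side without beta2, minus m4, is 1/n times
   the minimum over c of \<Sum> w i * (t i - c)^2, the second moment of the points about their weighted
   centre. This quantity increases with the weights and with the mutual distances of the points, and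
   for distinct integers both are smallest when x i = i, where it equals n (n^2 - 1) (n - 2) (n - 3) / 120. *)

theory Submission
  imports Defs
begin

text \<open>For positive total weight this is the moment of inertia about the weighted centre. The
  closed form has the same quotient shape as the bound to be proved; if the weights sum to 0, the
  quotient is 0 by convention.\<close>

definition inertia :: "'a set \<Rightarrow> ('a \<Rightarrow> real) \<Rightarrow> ('a \<Rightarrow> real) \<Rightarrow> real" where
  "inertia S w t = (\<Sum>i\<in>S. w i * t i ^ 2) - (\<Sum>i\<in>S. w i * t i) ^ 2 / (\<Sum>i\<in>S. w i)"

lemma sum_weighted_shift_square:
  fixes w t :: "'a \<Rightarrow> real"
  shows "(\<Sum>i\<in>S. w i * (t i - c) ^ 2)
    = (\<Sum>i\<in>S. w i * t i ^ 2) - 2 * c * (\<Sum>i\<in>S. w i * t i) + c ^ 2 * (\<Sum>i\<in>S. w i)"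
proof -
  have "(\<Sum>i\<in>S. w i * (t i - c) ^ 2)
      = (\<Sum>i\<in>S. w i * t i ^ 2 - 2 * c * (w i * t i) + c ^ 2 * w i)"
    by (intro sum.cong) (auto simp: power2_eq_square algebra_simps)
  then show ?thesis
    by (simp add: sum.distrib sum_subtractf sum_distrib_left)
qed

text \<open>Parallel-axis theorem: moving the reference point from the weighted centre to
  \<open>c\<close> adds the total weight times the squared displacement.\<close>

lemma inertia_le:
  assumes "(\<Sum>i\<in>S. w i) > 0"
  shows "inertia S w t \<le> (\<Sum>i\<in>S. w i * (t i - c) ^ 2)"
proof -
  let ?K = "\<Sum>i\<in>S. w i" and ?P = "\<Sum>i\<in>S. w i * t i"
  have "(\<Sum>i\<in>S. w i * (t i - c) ^ 2) - inertia S w t = ?K * (c - ?P / ?K) ^ 2"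
    using assms unfolding sum_weighted_shift_square inertia_def
    by (simp add: field_simps power2_eq_square)
  moreover have "\<dots> \<ge> 0"
    using assms by simp
  ultimately show ?thesis
    by linarith
qed

lemma inertia_attained:
  assumes "(\<Sum>i\<in>S. w i) \<noteq> 0"
  shows "inertia S w t
    = (\<Sum>i\<in>S. w i * (t i - (\<Sum>i\<in>S. w i * t i) / (\<Sum>i\<in>S. w i)) ^ 2)"
  using assms unfolding sum_weighted_shift_square inertia_def
  by (simp add: field_simps power2_eq_square)

text \<open>Lagrange's identity. The centre moves with the points, so comparing two configurations
  calls for a form in which only mutual distances occur.\<close>

lemma inertia_pairs:
  assumes "(\<Sum>i\<in>S. w i) \<noteq> 0"
  shows "inertia S w t
    = (\<Sum>i\<in>S. \<Sum>j\<in>S. w i * w j * (t i - t j) ^ 2) / (2 * (\<Sum>i\<in>S. w i))"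
proof -
  let ?K = "\<Sum>i\<in>S. w i" and ?P = "\<Sum>i\<in>S. w i * t i" and ?Q = "\<Sum>i\<in>S. w i * t i ^ 2"
  \<comment> \<open>The inner sum is the second moment about the point \<open>t i\<close>, so the
    shift formula applies with \<open>c = t i\<close>.\<close>
  have "(\<Sum>i\<in>S. \<Sum>j\<in>S. w i * w j * (t i - t j) ^ 2)
      = (\<Sum>i\<in>S. w i * (\<Sum>j\<in>S. w j * (t j - t i) ^ 2))"
    by (simp add: sum_distrib_left power2_commute mult.assoc)
  also have "\<dots> = (\<Sum>i\<in>S. ?Q * w i - 2 * ?P * (w i * t i) + ?K * (w i * t i ^ 2))"
    unfolding sum_weighted_shift_square by (intro sum.cong) (auto simp: algebra_simps)
  also have "\<dots> = 2 * (?K * ?Q - ?P ^ 2)"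
    by (simp add: sum.distrib sum_subtractf flip: sum_distrib_left)
       (simp add: power2_eq_square algebra_simps)
  finally have "(\<Sum>i\<in>S. \<Sum>j\<in>S. w i * w j * (t i - t j) ^ 2) / (2 * ?K)
      = (?K * ?Q - ?P ^ 2) / ?K"
    by (simp del: right_diff_distrib_numeral)
  then show ?thesis
    using assms by (simp add: inertia_def diff_divide_distrib)
qed

text \<open>Both sides are compared at the centre for \<open>w\<close>: it is optimal for
  \<open>w\<close> and merely one admissible reference point for \<open>v\<close>.\<close>

lemma inertia_mono_weights:
  assumes "\<And>i. i \<in> S \<Longrightarrow> v i \<le> w i" and "(\<Sum>i\<in>S. v i) > 0"
  shows "inertia S v t \<le> inertia S w t"
proof -
  have "(\<Sum>i\<in>S. w i) > 0"
    using assms sum_mono[of S v w] by auto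
  define c where "c = (\<Sum>i\<in>S. w i * t i) / (\<Sum>i\<in>S. w i)"
  have "inertia S v t \<le> (\<Sum>i\<in>S. v i * (t i - c) ^ 2)"
    by (rule inertia_le) fact
  also have "\<dots> \<le> (\<Sum>i\<in>S. w i * (t i - c) ^ 2)"
    by (intro sum_mono mult_right_mono assms) auto
  also have "\<dots> = inertia S w t"
    using \<open>(\<Sum>i\<in>S. w i) > 0\<close> by (simp add: inertia_attained c_def)
  finally show ?thesis .
qed

text \<open>In the pairwise form the denominator is fixed by the weights, and each term of the
  numerator grows with its distance.\<close>

lemma inertia_mono_distances:
  assumes "\<And>i. i \<in> S \<Longrightarrow> w i \<ge> 0" and "(\<Sum>i\<in>S. w i) > 0"
    and "\<And>i j. i \<in> S \<Longrightarrow> j \<in> S \<Longrightarrow> \<bar>s i - s j\<bar> \<le> \<bar>t i - t j\<bar>"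
  shows "inertia S w s \<le> inertia S w t"
proof -
  have "w i * w j * (s i - s j) ^ 2 \<le> w i * w j * (t i - t j) ^ 2" if "i \<in> S" "j \<in> S" for i j
    using assms that by (intro mult_left_mono) (auto simp flip: abs_le_square_iff)
  then show ?thesis
    using assms by (simp add: inertia_pairs divide_right_mono sum_mono)
qed

text \<open>Successive values are distinct integers, so each step contributes at least 1.\<close>

lemma strict_mono_on_Ints_gap:
  fixes x :: "nat \<Rightarrow> real"
  assumes "\<And>i. i \<in> {a..b} \<Longrightarrow> x i \<in> \<int>" and "strict_mono_on {a..b} x"
    and "a \<le> i" "i \<le> j" "j \<le> b"
  shows "real j - real i \<le> x j - x i"
  using \<open>i \<le> j\<close> \<open>j \<le> b\<close>
proof (induction j rule: dec_induct)
  case base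
  then show ?case by simp
next
  case (step k)
  have "x k < x (Suc k)"
    using assms(2) by (rule strict_mono_onD) (use step assms(3) in auto)
  moreover have "x k \<in> \<int>" "x (Suc k) \<in> \<int>"
    using assms(1,3) step by auto
  ultimately have "x k + 1 \<le> x (Suc k)"
    by (auto elim!: Ints_cases)
  then show ?case
    using step by simp
qed

context
  fixes n :: nat
begin

private lemma sums_of_powers:
  "(\<Sum>i=1..n. real i) = real n * (real n + 1) / 2"
  "(\<Sum>i=1..n. real i ^ 2) = real n * (real n + 1) * (2 * real n + 1) / 6"
  "(\<Sum>i=1..n. real i ^ 3) = (real n * (real n + 1) / 2) ^ 2"
  "(\<Sum>i=1..n. real i ^ 4)
     = real n * (real n + 1) * (2 * real n + 1) * (3 * real n ^ 2 + 3 * real n - 1) / 30"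
  by (induction n) (auto simp: field_simps power2_eq_square power3_eq_cube power4_eq_xxxx)

lemma sum_consecutive_weights:
  "(\<Sum>i=1..n. (real n - real i) * (real i - 1)) = real n * (real n - 1) * (real n - 2) / 6"
proof -
  have "(\<Sum>i=1..n. (real n - real i) * (real i - 1))
      = (\<Sum>i=1..n. (real n + 1) * real i - real i ^ 2 - real n)"
    by (intro sum.cong) (auto simp: power2_eq_square algebra_simps)
  also have "\<dots> = real n * (real n - 1) * (real n - 2) / 6"
    by (simp add: sum_subtractf sums_of_powers del: One_nat_def flip: sum_distrib_left)
       (simp add: field_simps power2_eq_square)
  finally show ?thesis .
qed

lemma inertia_consecutive:
  "inertia {1..n} (\<lambda>i. (real n - real i) * (real i - 1)) real
    = real n * (real n ^ 2 - 1) * (real n - 2) * (real n - 3) / 120"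
proof -
  let ?N = "real n"
  \<comment> \<open>The weights are symmetric under i -> n + 1 - i, so the centre is (n + 1) / 2 and
    this sum is the total weight times it.\<close>
  have P: "(\<Sum>i=1..n. (?N - real i) * (real i - 1) * real i)
      = ?N * (?N - 1) * (?N - 2) / 6 * ((?N + 1) / 2)"
  proof -
    have "(\<Sum>i=1..n. (?N - real i) * (real i - 1) * real i)
        = (\<Sum>i=1..n. (?N + 1) * real i ^ 2 - real i ^ 3 - ?N * real i)"
      by (intro sum.cong) (auto simp: power2_eq_square power3_eq_cube algebra_simps)
    also have "\<dots> = ?N * (?N - 1) * (?N - 2) / 6 * ((?N + 1) / 2)"
      by (simp add: sum_subtractf sums_of_powers del: One_nat_def flip: sum_distrib_left)
         (simp add: field_simps power2_eq_square)
    finally show ?thesis .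
  qed
  \<comment> \<open>Written as the claimed value plus total weight times squared centre, the term
    that the definition of \<open>inertia\<close> subtracts.\<close>
  have Q: "(\<Sum>i=1..n. (?N - real i) * (real i - 1) * real i ^ 2)
      = ?N * (?N ^ 2 - 1) * (?N - 2) * (?N - 3) / 120
        + ?N * (?N - 1) * (?N - 2) / 6 * ((?N + 1) / 2) ^ 2"
  proof -
    have "(\<Sum>i=1..n. (?N - real i) * (real i - 1) * real i ^ 2)
        = (\<Sum>i=1..n. (?N + 1) * real i ^ 3 - real i ^ 4 - ?N * real i ^ 2)"
      by (intro sum.cong)
         (auto simp: power2_eq_square power3_eq_cube power4_eq_xxxx algebra_simps)
    also have "\<dots> = ?N * (?N ^ 2 - 1) * (?N - 2) * (?N - 3) / 120
        + ?N * (?N - 1) * (?N - 2) / 6 * ((?N + 1) / 2) ^ 2"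
      by (simp add: sum_subtractf sums_of_powers del: One_nat_def flip: sum_distrib_left)
         (simp add: field_simps power2_eq_square)
    finally show ?thesis .
  qed
  \<comment> \<open>This includes \<open>K = 0\<close>, where the quotient is 0, so n < 3 needs no
    separate case.\<close>
  have "(K * c) ^ 2 / K = K * c ^ 2" for K c :: real
    by (simp add: power2_eq_square)
  then show ?thesis
    unfolding inertia_def sum_consecutive_weights P Q by (simp only: add_diff_cancel_right')
qed

end

text \<open>The right-hand side is the consecutive-integer inertia divided by n. Both sides have
  leading term n^4 / 120; their difference factors explicitly and vanishes only at n = 3.\<close>

lemma beta2_le:
  assumes "n \<ge> 3"
  shows "beta2 n \<le> (real n ^ 2 - 1) * (real n - 2) * (real n - 3) / 120"
proof -
  let ?N = "real n"
  have N: "?N \<ge> 3"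
    using assms by simp
  have sq: "3 * ?N \<le> ?N * ?N"
    using N by (intro mult_right_mono) auto
  show ?thesis
  proof (cases "even n")
    case True
    \<comment> \<open>The bound \<open>3 * ?N \<le> ?N * ?N\<close> is too weak for the quadratic
      factor below: it leaves only 20 - 5n. Evenness rules out n = 3 and gives the factor 4.\<close>
    then have "?N \<ge> 4"
      using assms by (cases "n = 3") auto
    then have "4 * ?N \<le> ?N * ?N"
      by (intro mult_right_mono) auto
    have "(?N ^ 2 - 1) * (?N - 2) * (?N - 3) / 120 - beta2 n
        = (?N - 2) * (15 * (?N * ?N) - 50 * ?N + 20) / 480"
      using True by (simp add: beta2_def field_simps power2_eq_square)
    moreover have "\<dots> \<ge> 0"
      using \<open>?N \<ge> 4\<close> \<open>4 * ?N \<le> ?N * ?N\<close> by simp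
    ultimately show ?thesis
      by linarith
  next
    case False
    have "(?N ^ 2 - 1) * (?N - 2) * (?N - 3) / 120 - beta2 n
        = (?N - 1) * (?N - 3) * (15 * (?N * ?N) - 40 * ?N + 5) / (480 * ?N)"
      using False N by (simp add: beta2_def field_simps power2_eq_square power3_eq_cube)
    moreover have "\<dots> \<ge> 0"
      using N sq by simp
    ultimately show ?thesis
      by linarith
  qed
qed

text \<open>Centring at the mean turns each weight into a quadratic in \<open>t i\<close>, so the
  three sums in \<open>inertia\<close> become n times combinations of central moments; the first
  moment vanishes.\<close>

lemma central_moments_inertia:
  fixes n :: nat and x :: "nat \<Rightarrow> real" and m M :: real
  assumes "n > 0"
  defines "a \<equiv> arith_mean n x"
  shows "inertia {1..n} (\<lambda>i. (M - x i) * (x i - m)) (\<lambda>i. x i - a) / real n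
    = (M - a) * (a - m) * central_moment 2 n x + (M + m - 2 * a) * central_moment 3 n x
      - (central_moment 3 n x - (m + M - 2 * a) * central_moment 2 n x) ^ 2
        / ((M - a) * (a - m) - central_moment 2 n x)
      - central_moment 4 n x"
proof -
  define N where "N = real n"
  define t where "t i = x i - a" for i
  have "N > 0"
    using assms by (simp add: N_def)
  have t0: "(\<Sum>i=1..n. t i) = 0"
    using \<open>n > 0\<close> by (simp add: t_def a_def arith_mean_def sum_subtractf)
  have moment: "(\<Sum>i=1..n. t i ^ k) = N * central_moment k n x" for k
    using \<open>n > 0\<close> by (simp add: central_moment_def t_def a_def N_def)
  define A B where "A = (M - a) * (a - m)" and "B = M + m - 2 * a"
  let ?w = "\<lambda>i. (M - x i) * (x i - m)"
  have w: "?w i = A + B * t i - t i ^ 2" for i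
    by (simp add: A_def B_def t_def power2_eq_square algebra_simps)
  have K: "(\<Sum>i=1..n. ?w i) = N * (A - central_moment 2 n x)"
    unfolding w
    by (simp add: sum.distrib sum_subtractf moment t0 del: One_nat_def flip: sum_distrib_left)
       (simp add: N_def algebra_simps)
  have P: "(\<Sum>i=1..n. ?w i * t i) = N * (B * central_moment 2 n x - central_moment 3 n x)"
  proof -
    have "(\<Sum>i=1..n. ?w i * t i) = (\<Sum>i=1..n. A * t i + B * t i ^ 2 - t i ^ 3)"
      unfolding w by (simp add: power2_eq_square power3_eq_cube algebra_simps)
    then show ?thesis
      by (simp add: sum.distrib sum_subtractf moment t0 del: One_nat_def flip: sum_distrib_left)
         (simp add: algebra_simps)
  qed
  have Q: "(\<Sum>i=1..n. ?w i * t i ^ 2)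
      = N * (A * central_moment 2 n x + B * central_moment 3 n x - central_moment 4 n x)"
  proof -
    have "(\<Sum>i=1..n. ?w i * t i ^ 2) = (\<Sum>i=1..n. A * t i ^ 2 + B * t i ^ 3 - t i ^ 4)"
      unfolding w
      by (simp add: power2_eq_square power3_eq_cube power4_eq_xxxx algebra_simps)
    then show ?thesis
      by (simp add: sum.distrib sum_subtractf moment del: One_nat_def flip: sum_distrib_left)
         (simp add: algebra_simps)
  qed
  \<comment> \<open>The factor \<open>N\<close> cancels even for \<open>k = 0\<close>, where both
    quotients are 0.\<close>
  have "(N * q - (N * p) ^ 2 / (N * k)) / N = q - p ^ 2 / k" for p q k
    using \<open>N > 0\<close> by (simp add: power2_eq_square diff_divide_distrib)
  then have "inertia {1..n} ?w t / N
      = A * central_moment 2 n x + B * central_moment 3 n x - central_moment 4 n x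
        - (B * central_moment 2 n x - central_moment 3 n x) ^ 2 / (A - central_moment 2 n x)"
    unfolding inertia_def K P Q by simp
  moreover have "t = (\<lambda>i. x i - a)"
    by (auto simp: t_def)
  ultimately show ?thesis
    by (simp add: A_def B_def N_def power2_commute add.commute)
qed

theorem theorem2p11:
  fixes n :: nat and x :: "nat \<Rightarrow> real" and m M :: real
  assumes "n \<ge> 3"
    and "\<And>i. i \<in> {1..n} \<Longrightarrow> x i \<in> \<int>"
    and "strict_mono_on {1..n} x"
    and "m = x 1" and "M = x n"
  shows "let a = arith_mean n x;
             m2 = central_moment 2 n x;
             m3 = central_moment 3 n x;
             m4 = central_moment 4 n x
         in m4 \<le> (M - a) * (a - m) * m2 + (M + m - 2 * a) * m3
                 - (m3 - (m + M - 2 * a) * m2) ^ 2 / ((M - a) * (a - m) - m2)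
                 - beta2 n"
proof -
  define a where "a = arith_mean n x"
  define v where "v i = (real n - real i) * (real i - 1)" for i
  define w where "w i = (M - x i) * (x i - m)" for i
  have gap: "real j - real i \<le> x j - x i" if "1 \<le> i" "i \<le> j" "j \<le> n" for i j
    using assms(2,3) that by (rule strict_mono_on_Ints_gap)
  \<comment> \<open>The gaps from \<open>x i\<close> to the two extremes bound the factors of
    \<open>w i\<close> below by the nonnegative factors of \<open>v i\<close>.\<close>
  have v_le_w: "v i \<le> w i" and v_nonneg: "v i \<ge> 0" if "i \<in> {1..n}" for i
    using that gap[of 1 i] gap[of i n] unfolding v_def w_def assms(4,5)
    by (auto intro!: mult_mono)
  \<comment> \<open>The weights at both endpoints are 0; positivity comes from an interior point,
    which exists since n is at least 3.\<close>
  have sum_v: "(\<Sum>i=1..n. v i) > 0"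
    using \<open>n \<ge> 3\<close> by (simp only: v_def sum_consecutive_weights) simp
  have dist: "\<bar>real i - real j\<bar> \<le> \<bar>(x i - a) - (x j - a)\<bar>" if "i \<in> {1..n}" "j \<in> {1..n}" for i j
    using that gap[of i j] gap[of j i] by (cases "i \<le> j") auto
  have "real n * beta2 n \<le> real n * ((real n ^ 2 - 1) * (real n - 2) * (real n - 3) / 120)"
    using \<open>n \<ge> 3\<close> by (intro mult_left_mono beta2_le) auto
  also have "\<dots> = inertia {1..n} v real"
    unfolding v_def inertia_consecutive by simp
  \<comment> \<open>First the points are spread apart under the fixed weights \<open>v\<close>, then
    the weights are raised to \<open>w\<close> at the fixed points.\<close>
  also have "\<dots> \<le> inertia {1..n} v (\<lambda>i. x i - a)"
    using v_nonneg sum_v dist by (rule inertia_mono_distances)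
  also have "\<dots> \<le> inertia {1..n} w (\<lambda>i. x i - a)"
    using v_le_w sum_v by (rule inertia_mono_weights)
  finally have "beta2 n \<le> inertia {1..n} w (\<lambda>i. x i - a) / real n"
    using \<open>n \<ge> 3\<close> by (simp add: field_simps)
  also have "\<dots> = (M - a) * (a - m) * central_moment 2 n x
      + (M + m - 2 * a) * central_moment 3 n x
      - (central_moment 3 n x - (m + M - 2 * a) * central_moment 2 n x) ^ 2
        / ((M - a) * (a - m) - central_moment 2 n x)
      - central_moment 4 n x"
    using \<open>n \<ge> 3\<close> unfolding w_def a_def by (intro central_moments_inertia) simp
  finally show ?thesis
    by (simp add: Let_def a_def)
qed

end
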